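(* Let $X$ be a non-empty finite set and let $R:X^2\to X^2$ be a bijection. (i) $R$ is non-degenerate if and only if the associated $2$-graph $\mathbb{F}_R^+$ has the unique pullback and pushout properties. (ii) Suppose that $R$ is a solution of the Yang–Baxter equation on $X$. Then $R$ is non-degenerate if and only if its associated $k$-graph $\mathbb{F}_R^+$ has the unique pullback and pushout properties for any $k\ge2$.
   Context: A bijection $R:X^2\to X^2$ is a (set-theoretic) solution of the Yang–Baxter equation on $X$ if $R_{12}R_{23}R_{12}=R_{23}R_{12}R_{23}$ on $X^3$, where $R_{12}=R\times\mathrm{id}_X$, $R_{23}=\mathrm{id}_X\times R$. Writing $R(x,y)=(u,v)$, $R$ is non-degenerate if $x\mapsto v$ is a bijection of $X$ for each fixed $y$ and $y\mapsto u$ is a bijection of $X$ for each fixed $x$. For $k\ge2$, the associated $k$-graph $\mathbb{F}_R^+$ of $R$ is the unital semigroup generated by $e^i_{\mathfrak s}$ ($1\le i\le k$, $\mathfrak s\in X$) subject to $e^i_{\mathfrak s}e^j_{\mathfrak t}=e^j_{\mathfrak t'}e^i_{\mathfrak s'}$ for $1\le i<j\le k$ whenever $R(\mathfrak s,\mathfrak t)=(\mathfrak t',\mathfrak s')$, with degree homomorphism to $\mathbb{N}^k$ sending $e^i_{\mathfrak s}$ to the $i$th standard basis vector. (For $k=2$ this is a single-vertex $2$-graph for every bijection $R$; for $k\ge3$ it is a single-vertex $k$-graph when $R$ is a Yang–Baxter solution.) A single-vertex $k$-graph generated by edges $e^i_{\mathfrak s}$ of degree $\epsilon_i$ ($1\le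 i\le k$) has the unique pullback property if for any pair $(e^i_{\mathfrak s},e^j_{\mathfrak t})$ with $i\ne j$ there is a unique pair $(e^j_{\mathfrak t'},e^i_{\mathfrak s'})$ such that $e^i_{\mathfrak s}e^j_{\mathfrak t'}=e^j_{\mathfrak t}e^i_{\mathfrak s'}$. It has the unique pushout property if for any pair $(e^i_{\mathfrak s'},e^j_{\mathfrak t'})$ with $i\ne j$ there is a unique pair $(e^j_{\mathfrak t},e^i_{\mathfrak s})$ such that $e^i_{\mathfrak s}e^j_{\mathfrak t'}=e^j_{\mathfrak t}e^i_{\mathfrak s'}$. *)

theory Defs
  imports "HOL-Algebra.Group"
begin

section \<open>Set-theoretic solutions of the Yang-Baxter equation\<close>

definition R12 :: "('a \<times> 'a \<Rightarrow> 'a \<times> 'a) \<Rightarrow> 'a \<times> 'a \<times> 'a \<Rightarrow> 'a \<times> 'a \<times> 'a" where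
  "R12 R = (\<lambda>(x, y, z). case R (x, y) of (u, v) \<Rightarrow> (u, v, z))"

definition R23 :: "('a \<times> 'a \<Rightarrow> 'a \<times> 'a) \<Rightarrow> 'a \<times> 'a \<times> 'a \<Rightarrow> 'a \<times> 'a \<times> 'a" where
  "R23 R = map_prod id R"

definition yang_baxter_solution :: "'a set \<Rightarrow> ('a \<times> 'a \<Rightarrow> 'a \<times> 'a) \<Rightarrow> bool" where
  "yang_baxter_solution X R \<longleftrightarrow>
     bij_betw R (X \<times> X) (X \<times> X) \<and>
     (\<forall>p \<in> X \<times> X \<times> X. R12 R (R23 R (R12 R p)) = R23 R (R12 R (R23 R p)))"

definition nondegenerate :: "'a set \<Rightarrow> ('a \<times> 'a \<Rightarrow> 'a \<times> 'a) \<Rightarrow> bool" where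
  "nondegenerate X R \<longleftrightarrow>
     (\<forall>y\<in>X. bij_betw (\<lambda>x. snd (R (x, y))) X X) \<and>
     (\<forall>x\<in>X. bij_betw (\<lambda>y. fst (R (x, y))) X X)"


section \<open>Monoids given by generators and relations\<close>

text \<open>The least congruence on the free monoid of words over \<open>A\<close> that contains the
  relations \<open>rel\<close>.\<close>

inductive_set pres_cong :: "'g set \<Rightarrow> ('g list \<times> 'g list) set \<Rightarrow> ('g list \<times> 'g list) set"
  for A :: "'g set" and rel :: "('g list \<times> 'g list) set" where
  base: "(p, q) \<in> rel \<Longrightarrow> p \<in> lists A \<Longrightarrow> q \<in> lists A \<Longrightarrow> (p, q) \<in> pres_cong A rel"
| refl: "w \<in> lists A \<Longrightarrow> (w, w) \<in> pres_cong A rel"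
| sym: "(u, v) \<in> pres_cong A rel \<Longrightarrow> (v, u) \<in> pres_cong A rel"
| trans: "(u, v) \<in> pres_cong A rel \<Longrightarrow> (v, w) \<in> pres_cong A rel \<Longrightarrow> (u, w) \<in> pres_cong A rel"
| append: "(u, u') \<in> pres_cong A rel \<Longrightarrow> (v, v') \<in> pres_cong A rel
    \<Longrightarrow> (u @ v, u' @ v') \<in> pres_cong A rel"

definition pres_monoid :: "'g set \<Rightarrow> ('g list \<times> 'g list) set \<Rightarrow> 'g list set monoid" where
  "pres_monoid A rel =
     \<lparr> carrier = lists A // pres_cong A rel,
       monoid.mult = (\<lambda>a b. \<Union>u\<in>a. \<Union>v\<in>b. pres_cong A rel `` {u @ v}),
       one = pres_cong A rel `` {[]} \<rparr>"


section \<open>Single-vertex graded semigroups and the pullback and pushout properties\<close>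

text \<open>A single-vertex \<open>k\<close>-graph is a monoid with a degree homomorphism to \<open>\<nat>\<^sup>k\<close> that has the
  unique factorisation property; the pullback and pushout properties involve only the product
  and the edges, i.e. the elements whose degree is a standard basis vector. Elements of
  \<open>\<nat>\<^sup>k\<close> are represented as functions \<open>nat \<Rightarrow> nat\<close> vanishing outside \<open>{1..k}\<close>. That the edges of
  the \<open>k\<close>-graph of a bijection are its generators is \<open>edges_YB_graph\<close> below.\<close>

record 'm graded_monoid = "'m monoid" +
  deg :: "'m \<Rightarrow> nat \<Rightarrow> nat"

definition unit_vec :: "nat \<Rightarrow> nat \<Rightarrow> nat" where
  "unit_vec i = (\<lambda>m. if m = i then 1 else 0)"

definition edges :: "('m, 'b) graded_monoid_scheme \<Rightarrow> nat \<Rightarrow> 'm set" where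
  "edges G i = {x \<in> carrier G. deg G x = unit_vec i}"

definition unique_pullback :: "nat \<Rightarrow> ('m, 'b) graded_monoid_scheme \<Rightarrow> bool" where
  "unique_pullback k G \<longleftrightarrow>
     (\<forall>i\<in>{1..k}. \<forall>j\<in>{1..k}. i \<noteq> j \<longrightarrow>
       (\<forall>x\<in>edges G i. \<forall>y\<in>edges G j.
          \<exists>!p. p \<in> edges G j \<times> edges G i \<and> x \<otimes>\<^bsub>G\<^esub> fst p = y \<otimes>\<^bsub>G\<^esub> snd p))"

definition unique_pushout :: "nat \<Rightarrow> ('m, 'b) graded_monoid_scheme \<Rightarrow> bool" where
  "unique_pushout k G \<longleftrightarrow>
     (\<forall>i\<in>{1..k}. \<forall>j\<in>{1..k}. i \<noteq> j \<longrightarrow>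
       (\<forall>x'\<in>edges G i. \<forall>y'\<in>edges G j.
          \<exists>!p. p \<in> edges G j \<times> edges G i \<and> snd p \<otimes>\<^bsub>G\<^esub> y' = fst p \<otimes>\<^bsub>G\<^esub> x'))"


section \<open>The \<open>k\<close>-graph of a bijection\<close>

text \<open>The letter \<open>(i, s)\<close> stands for the generator \<open>e\<close> with upper index \<open>i\<close> and lower
  index \<open>s\<close>.\<close>

definition YB_gens :: "nat \<Rightarrow> 'a set \<Rightarrow> (nat \<times> 'a) set" where
  "YB_gens k X = {1..k} \<times> X"

definition YB_rels ::
  "nat \<Rightarrow> 'a set \<Rightarrow> ('a \<times> 'a \<Rightarrow> 'a \<times> 'a) \<Rightarrow> ((nat \<times> 'a) list \<times> (nat \<times> 'a) list) set" where
  "YB_rels k X R =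
     {([(i, s), (j, t)], [(j, t'), (i, s')]) | i j s t s' t'.
        1 \<le> i \<and> i < j \<and> j \<le> k \<and> s \<in> X \<and> t \<in> X \<and> R (s, t) = (t', s')}"

definition word_deg :: "(nat \<times> 'a) list \<Rightarrow> nat \<Rightarrow> nat" where
  "word_deg w i = count_list (map fst w) i"

text \<open>Both sides of each relation have the same degree, so \<open>word_deg\<close> is constant on each
  congruence class and \<open>the_elem\<close> picks that constant; see \<open>YB_graph_deg\<close> below.\<close>

definition YB_graph ::
  "nat \<Rightarrow> 'a set \<Rightarrow> ('a \<times> 'a \<Rightarrow> 'a \<times> 'a) \<Rightarrow> (nat \<times> 'a) list set graded_monoid" where
  "YB_graph k X R = monoid.extend (pres_monoid (YB_gens k X) (YB_rels k X R))
     \<lparr> deg = (\<lambda>c. the_elem (word_deg ` c)) \<rparr>"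


section \<open>Well-definedness\<close>

lemma equiv_pres_cong: "equiv (lists A) (pres_cong A rel)"
proof -
  have "u \<in> lists A \<and> v \<in> lists A" if "(u, v) \<in> pres_cong A rel" for u v
    using that by induction auto
  then show ?thesis
    by (intro equivI refl_onI symI transI) (auto intro: pres_cong.intros)
qed

lemma pres_monoid_mult:
  assumes "u \<in> lists A" "v \<in> lists A"
  shows "pres_cong A rel `` {u} \<otimes>\<^bsub>pres_monoid A rel\<^esub> pres_cong A rel `` {v}
       = pres_cong A rel `` {u @ v}"
proof -
  let ?C = "pres_cong A rel"
  have eq: "?C `` {u' @ v'} = ?C `` {u @ v}" if "u' \<in> ?C `` {u}" "v' \<in> ?C `` {v}" for u' v'
    using that by (intro equiv_class_eq[OF equiv_pres_cong, symmetric]) (auto intro: pres_cong.append)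
  have "u \<in> ?C `` {u}" "v \<in> ?C `` {v}"
    using assms by (auto intro: pres_cong.refl)
  then have "(\<Union>u'\<in>?C `` {u}. \<Union>v'\<in>?C `` {v}. ?C `` {u' @ v'}) = ?C `` {u @ v}"
    using eq by blast
  then show ?thesis
    by (simp only: pres_monoid_def monoid.simps)
qed

lemma monoid_pres_monoid: "monoid (pres_monoid A rel)"
proof -
  let ?M = "pres_monoid A rel" and ?C = "\<lambda>w. pres_cong A rel `` {w}"
  have car: "\<exists>w\<in>lists A. x = ?C w" if "x \<in> carrier ?M" for x
    using that by (auto simp: pres_monoid_def elim!: quotientE)
  have cls: "?C w \<in> carrier ?M" if "w \<in> lists A" for w
    using that by (auto simp: pres_monoid_def intro: quotientI)
  have one: "\<one>\<^bsub>?M\<^esub> = ?C []"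
    by (simp add: pres_monoid_def)
  show ?thesis
  proof (rule monoidI)
    fix x y assume "x \<in> carrier ?M" "y \<in> carrier ?M"
    then obtain u v where "u \<in> lists A" "x = ?C u" "v \<in> lists A" "y = ?C v"
      using car by meson
    then show "x \<otimes>\<^bsub>?M\<^esub> y \<in> carrier ?M"
      by (simp only: pres_monoid_mult) (rule cls, simp)
  next
    show "\<one>\<^bsub>?M\<^esub> \<in> carrier ?M"
      unfolding one by (rule cls) simp
  next
    fix x y z assume "x \<in> carrier ?M" "y \<in> carrier ?M" "z \<in> carrier ?M"
    then obtain u v w where "u \<in> lists A" "x = ?C u" "v \<in> lists A" "y = ?C v"
        "w \<in> lists A" "z = ?C w"
      using car by meson
    then show "x \<otimes>\<^bsub>?M\<^esub> y \<otimes>\<^bsub>?M\<^esub> z = x \<otimes>\<^bsub>?M\<^esub> (y \<otimes>\<^bsub>?M\<^esub> z)"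
      by (simp only: pres_monoid_mult append_in_lists_conv append_assoc simp_thms)
  next
    fix x assume "x \<in> carrier ?M"
    then obtain u where "u \<in> lists A" "x = ?C u"
      using car by meson
    then show "\<one>\<^bsub>?M\<^esub> \<otimes>\<^bsub>?M\<^esub> x = x" "x \<otimes>\<^bsub>?M\<^esub> \<one>\<^bsub>?M\<^esub> = x"
      unfolding one by (simp_all only: pres_monoid_mult lists.Nil append_Nil append_Nil2)
  qed
qed

lemma YB_graph_monoid_simps [simp]:
  "carrier (YB_graph k X R) = carrier (pres_monoid (YB_gens k X) (YB_rels k X R))"
  "monoid.mult (YB_graph k X R) = monoid.mult (pres_monoid (YB_gens k X) (YB_rels k X R))"
  "one (YB_graph k X R) = one (pres_monoid (YB_gens k X) (YB_rels k X R))"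
  by (simp_all add: YB_graph_def monoid.extend_def)

lemma monoid_YB_graph: "monoid (YB_graph k X R)"
  using monoid_pres_monoid[of "YB_gens k X" "YB_rels k X R"]
  unfolding Group.monoid_def YB_graph_monoid_simps .

lemma word_deg_cong:
  "(u, v) \<in> pres_cong (YB_gens k X) (YB_rels k X R) \<Longrightarrow> word_deg u = word_deg v"
  by (induction rule: pres_cong.induct) (auto simp: YB_rels_def word_deg_def fun_eq_iff)

lemma YB_graph_deg:
  assumes "w \<in> lists (YB_gens k X)"
  shows "deg (YB_graph k X R) (pres_cong (YB_gens k X) (YB_rels k X R) `` {w}) = word_deg w"
proof -
  have "word_deg ` (pres_cong (YB_gens k X) (YB_rels k X R) `` {w}) = {word_deg w}"
    using pres_cong.refl[OF assms, of "YB_rels k X R"]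
    by (force dest: word_deg_cong)
  then show ?thesis
    by (simp add: YB_graph_def monoid.extend_def)
qed

lemma edges_YB_graph:
  assumes "i \<in> {1..k}"
  shows "edges (YB_graph k X R) i
       = (\<lambda>s. pres_cong (YB_gens k X) (YB_rels k X R) `` {[(i, s)]}) ` X"
proof -
  let ?C = "pres_cong (YB_gens k X) (YB_rels k X R)"
  have len1: "\<exists>s. w = [(i, s)]" if "word_deg w = unit_vec i" for w :: "(nat \<times> 'a) list"
  proof -
    have *: "count_list (map fst w) m = (if m = i then 1 else 0)" for m
      using fun_cong[OF that, of m] by (simp add: word_deg_def unit_vec_def)
    show ?thesis
    proof (cases w)
      case Nil
      then show ?thesis using *[of i] by simp
    next
      case (Cons g w')
      have g: "fst g = i"
        using *[of "fst g"] Cons by (auto split: if_splits)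
      have "count_list (map fst w') m = 0" for m
        using *[of m] Cons g by (auto split: if_splits)
      then have "w' = []"
        by (metis count_list_0_iff list.map_disc_iff list.set_intros(1) neq_Nil_conv)
      then show ?thesis
        using Cons g by (cases g) auto
    qed
  qed
  have unit: "word_deg [(i, s)] = unit_vec i" for s :: 'a
    by (auto simp: word_deg_def unit_vec_def)
  show ?thesis
  proof (intro equalityI subsetI)
    fix x assume x: "x \<in> edges (YB_graph k X R) i"
    then obtain w where w: "w \<in> lists (YB_gens k X)" "x = ?C `` {w}"
      by (auto simp: edges_def pres_monoid_def elim!: quotientE)
    then obtain s where "w = [(i, s)]"
      using x len1 YB_graph_deg[OF w(1), of R] by (auto simp: edges_def)
    then show "x \<in> (\<lambda>s. ?C `` {[(i, s)]}) ` X"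
      using w by (auto simp: YB_gens_def)
  next
    fix x assume "x \<in> (\<lambda>s. ?C `` {[(i, s)]}) ` X"
    then obtain s where s: "s \<in> X" "x = ?C `` {[(i, s)]}" by auto
    have w: "[(i, s)] \<in> lists (YB_gens k X)"
      using s assms by (auto simp: YB_gens_def)
    show "x \<in> edges (YB_graph k X R) i"
      using YB_graph_deg[OF w, of R] w s
      by (auto simp: edges_def unit pres_monoid_def intro: quotientI)
  qed
qed

end

theory Submission
  imports Defs
begin

text \<open>
  Non-degeneracy and the two unique completion properties express the same thing once it is
  known which squares \<open>e\<^sub>i(s) e\<^sub>j(t) = e\<^sub>j(t') e\<^sub>i(s')\<close> commute: for \<open>i < j\<close> these are exactly the
  defining ones, \<open>R (s, t) = (t', s')\<close>. This is \<open>YB_edge_mult_eq_iff\<close>; its content is that the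
  congruence generated by the relations identifies no further words of length two.

  Given \<open>s\<close> and \<open>t'\<close> (a pullback problem), the square is determined by \<open>t\<close>, which must
  solve \<open>fst (R (s, t)) = t'\<close>; so unique pullbacks say that every map \<open>t \<mapsto> fst (R (s, t))\<close> is a
  bijection of \<open>X\<close>. Given \<open>t\<close> and \<open>s'\<close> (a pushout problem), it is determined by \<open>s\<close>, which must
  solve \<open>snd (R (s, t)) = s'\<close>; so unique pushouts say that every map \<open>s \<mapsto> snd (R (s, t))\<close> is a
  bijection of \<open>X\<close>. Problems with \<open>i > j\<close> are the mirror images of those with \<open>i < j\<close> and
  impose the same condition. The argument looks at two colours at a time, so it is the same for
  every \<open>k \<ge> 2\<close>.
\<close>

section \<open>Products of two edges\<close>

(* Products of edges are compared in YB_graph itself; simplification would move them to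
   pres_monoid and out of reach of the lemmas below. *)
declare YB_graph_monoid_simps [simp del]

definition YB_edge ::
  "nat \<Rightarrow> 'a set \<Rightarrow> ('a \<times> 'a \<Rightarrow> 'a \<times> 'a) \<Rightarrow> nat \<Rightarrow> 'a \<Rightarrow> (nat \<times> 'a) list set" where
  "YB_edge k X R i s = pres_cong (YB_gens k X) (YB_rels k X R) `` {[(i, s)]}"

text \<open>The relations read from left to right, as a normal form for words of length two in which
  the larger colour comes first. The two sides of a relation have the same normal form, so it can
  tell congruence classes of such words apart.\<close>

fun swap_pair :: "('a \<times> 'a \<Rightarrow> 'a \<times> 'a) \<Rightarrow> (nat \<times> 'a) list \<Rightarrow> (nat \<times> 'a) list" where
  "swap_pair R [(i, s), (j, t)] =
     (if i < j then [(j, fst (R (s, t))), (i, snd (R (s, t)))] else [(i, s), (j, t)])"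
| "swap_pair R w = w"

lemma swap_pair_id: "length w \<noteq> 2 \<Longrightarrow> swap_pair R w = w"
  by (cases "(R, w)" rule: swap_pair.cases) auto

text \<open>The induction passes through products because a word of length at most two splits
  properly only into two letters, and congruent words of length at most one are equal.\<close>

lemma pres_cong_swap_pair:
  assumes "(u, v) \<in> pres_cong (YB_gens k X) (YB_rels k X R)"
  shows "length u = length v \<and> (length u \<le> 2 \<longrightarrow> swap_pair R u = swap_pair R v)"
  using assms
proof induction
  case (append u u' v v')
  have "swap_pair R (u @ v) = swap_pair R (u' @ v')" if len: "length (u @ v) \<le> 2"
  proof -
    consider "length u = 0" | "length v = 0" | "length u = 1" "length v = 1"
      using len by (cases "length u"; cases "length v") auto
    then show ?thesis
      using append.IH len by cases (auto simp: swap_pair_id)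
  qed
  then show ?case
    using append.IH by simp
qed (auto simp: YB_rels_def)

lemma letter_in_lists_gens: "i \<in> {1..k} \<Longrightarrow> s \<in> X \<Longrightarrow> [(i, s)] \<in> lists (YB_gens k X)"
  by (simp add: YB_gens_def)

lemma pres_class_eq_iff:
  assumes "u \<in> lists A" "v \<in> lists A"
  shows "pres_cong A rel `` {u} = pres_cong A rel `` {v} \<longleftrightarrow> (u, v) \<in> pres_cong A rel"
  using eq_equiv_class_iff[OF equiv_pres_cong assms] .

lemma edges_eq_YB_edge: "i \<in> {1..k} \<Longrightarrow> edges (YB_graph k X R) i = YB_edge k X R i ` X"
  by (simp add: edges_YB_graph YB_edge_def)

lemma inj_on_YB_edge:
  assumes "i \<in> {1..k}"
  shows "inj_on (YB_edge k X R i) X"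
proof (rule inj_onI)
  fix s t assume st: "s \<in> X" "t \<in> X" and "YB_edge k X R i s = YB_edge k X R i t"
  then have "([(i, s)], [(i, t)]) \<in> pres_cong (YB_gens k X) (YB_rels k X R)"
    using assms by (simp add: YB_edge_def pres_class_eq_iff YB_gens_def)
  from pres_cong_swap_pair[OF this] show "s = t"
    by simp
qed

lemma YB_edge_mult:
  assumes "i \<in> {1..k}" "j \<in> {1..k}" "s \<in> X" "t \<in> X"
  shows "YB_edge k X R i s \<otimes>\<^bsub>YB_graph k X R\<^esub> YB_edge k X R j t
       = pres_cong (YB_gens k X) (YB_rels k X R) `` {[(i, s), (j, t)]}"
  using pres_monoid_mult[OF letter_in_lists_gens[OF assms(1,3)] letter_in_lists_gens[OF assms(2,4)]]
  by (simp add: YB_edge_def YB_graph_monoid_simps)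

text \<open>For \<open>i < j\<close> the left word is rewritten by \<open>swap_pair\<close> while the right one is already
  normal, so comparing normal forms gives back the defining relation.\<close>

lemma YB_edge_mult_eq_iff:
  assumes "i \<in> {1..k}" "j \<in> {1..k}" "i < j"
    and "s \<in> X" "t \<in> X" "t' \<in> X" "s' \<in> X"
  shows "YB_edge k X R i s \<otimes>\<^bsub>YB_graph k X R\<^esub> YB_edge k X R j t
       = YB_edge k X R j t' \<otimes>\<^bsub>YB_graph k X R\<^esub> YB_edge k X R i s'
     \<longleftrightarrow> R (s, t) = (t', s')"
proof -
  let ?u = "[(i, s), (j, t)]" and ?v = "[(j, t'), (i, s')]"
  let ?C = "pres_cong (YB_gens k X) (YB_rels k X R)"
  have words: "?u \<in> lists (YB_gens k X)" "?v \<in> lists (YB_gens k X)"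
    using assms by (auto simp: YB_gens_def)
  have "(?u, ?v) \<in> ?C \<longleftrightarrow> R (s, t) = (t', s')"
  proof
    assume "(?u, ?v) \<in> ?C"
    from pres_cong_swap_pair[OF this] show "R (s, t) = (t', s')"
      using assms by (simp add: prod_eq_iff)
  next
    assume "R (s, t) = (t', s')"
    then have "(?u, ?v) \<in> YB_rels k X R"
      using assms by (auto simp: YB_rels_def)
    then show "(?u, ?v) \<in> ?C"
      using words by (rule pres_cong.base)
  qed
  then show ?thesis
    using assms words by (simp add: YB_edge_mult pres_class_eq_iff)
qed

section \<open>Unique completion of squares\<close>

text \<open>Only inverse bijections between the solutions of the two problems are asked for, so that a
  problem about pairs can be exchanged for one about single elements.\<close>

lemma ex1_transfer:
  assumes "\<And>a. a \<in> A \<Longrightarrow> P a \<Longrightarrow> f a \<in> T \<and> Q (f a) \<and> g (f a) = a"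
    and "\<And>q. q \<in> T \<Longrightarrow> Q q \<Longrightarrow> g q \<in> A \<and> P (g q) \<and> f (g q) = q"
  shows "(\<exists>!q. q \<in> T \<and> Q q) \<longleftrightarrow> (\<exists>!a. a \<in> A \<and> P a)"
proof
  assume "\<exists>!q. q \<in> T \<and> Q q"
  then obtain q where q: "q \<in> T" "Q q" and uniq: "\<And>q'. q' \<in> T \<Longrightarrow> Q q' \<Longrightarrow> q' = q"
    by (auto elim!: ex1E)
  have "a = g q" if "a \<in> A \<and> P a" for a
    using that assms(1)[of a] assms(2)[of q] uniq[of "f a"] by metis
  then show "\<exists>!a. a \<in> A \<and> P a"
    using assms(2)[OF q] by (intro ex1I[of _ "g q"]) simp_all
next
  assume "\<exists>!a. a \<in> A \<and> P a"
  then obtain a where a: "a \<in> A" "P a" and uniq: "\<And>a'. a' \<in> A \<Longrightarrow> P a' \<Longrightarrow> a' = a"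
    by (auto elim!: ex1E)
  have "q = f a" if "q \<in> T \<and> Q q" for q
    using that assms(2)[of q] uniq[of "g q"] by metis
  then show "\<exists>!q. q \<in> T \<and> Q q"
    using assms(1)[OF a] by (intro ex1I[of _ "f a"]) simp_all
qed

lemma ex1_Times_image_iff:
  assumes "inj_on f A" "inj_on g B"
  shows "(\<exists>!p. p \<in> (f ` A) \<times> (g ` B) \<and> P (fst p) (snd p))
     \<longleftrightarrow> (\<exists>!q. q \<in> A \<times> B \<and> P (f (fst q)) (g (snd q)))"
  using assms
  by (intro ex1_transfer[where f = "map_prod f g" and g = "map_prod (inv_into A f) (inv_into B g)"])
    (auto simp: mem_Times_iff)

lemma bij_betw_iff_ex1:
  assumes "\<And>x. x \<in> A \<Longrightarrow> f x \<in> B"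
  shows "bij_betw f A B \<longleftrightarrow> (\<forall>y\<in>B. \<exists>!x. x \<in> A \<and> f x = y)"
  using assms unfolding bij_betw_def inj_on_def image_def by blast

text \<open>Whether a pair of edges can be completed depends on the colours only through the order
  of \<open>i\<close> and \<open>j\<close>, and exchanging the colours exchanges the roles of the two edges; so a single
  condition without colours remains, and two colours are enough to detect it.\<close>

lemma all_colour_pairs_iff:
  fixes k :: nat
  assumes "k \<ge> 2"
    and less: "\<And>i j. i \<in> {1..k} \<Longrightarrow> j \<in> {1..k} \<Longrightarrow> i < j \<Longrightarrow>
      (\<forall>s\<in>X. \<forall>t\<in>X. Q i j s t \<longleftrightarrow> S s t)"
    and greater: "\<And>i j. i \<in> {1..k} \<Longrightarrow> j \<in> {1..k} \<Longrightarrow> j < i \<Longrightarrow>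
      (\<forall>s\<in>X. \<forall>t\<in>X. Q i j s t \<longleftrightarrow> S t s)"
  shows "(\<forall>i\<in>{1..k}. \<forall>j\<in>{1..k}. i \<noteq> j \<longrightarrow> (\<forall>s\<in>X. \<forall>t\<in>X. Q i j s t))
     \<longleftrightarrow> (\<forall>s\<in>X. \<forall>t\<in>X. S s t)"
proof
  assume all: "\<forall>i\<in>{1..k}. \<forall>j\<in>{1..k}. i \<noteq> j \<longrightarrow> (\<forall>s\<in>X. \<forall>t\<in>X. Q i j s t)"
  have "1 \<in> {1..k}" "2 \<in> {1..k}"
    using assms(1) by auto
  then show "\<forall>s\<in>X. \<forall>t\<in>X. S s t"
    using all less[of 1 2] by simp
next
  assume "\<forall>s\<in>X. \<forall>t\<in>X. S s t"
  then show "\<forall>i\<in>{1..k}. \<forall>j\<in>{1..k}. i \<noteq> j \<longrightarrow> (\<forall>s\<in>X. \<forall>t\<in>X. Q i j s t)"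
    using less greater by (metis linorder_neqE_nat)
qed

text \<open>A commuting square is fixed by the two arguments of \<open>R\<close>. One of them is given in a pullback
  problem; the other is sought and its completion is forced, being the second component of the
  value of \<open>R\<close>. Uniqueness of pairs thus becomes uniqueness of one element.\<close>

lemma unique_pullback_YB_graph_iff:
  assumes R: "R ` (X \<times> X) \<subseteq> X \<times> X" and "k \<ge> 2"
  shows "unique_pullback k (YB_graph k X R)
     \<longleftrightarrow> (\<forall>s\<in>X. bij_betw (\<lambda>t. fst (R (s, t))) X X)"
proof -
  let ?G = "YB_graph k X R" and ?e = "YB_edge k X R"
  let ?Q = "\<lambda>i j s t'. \<exists>!p. p \<in> edges ?G j \<times> edges ?G i \<and> ?e i s \<otimes>\<^bsub>?G\<^esub> fst p = ?e j t' \<otimes>\<^bsub>?G\<^esub> snd p"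
  let ?S = "\<lambda>s t'. \<exists>!t. t \<in> X \<and> fst (R (s, t)) = t'"
  have closed: "fst (R (s, t)) \<in> X" "snd (R (s, t)) \<in> X" if "s \<in> X" "t \<in> X" for s t
    using R that by (auto simp: image_subset_iff mem_Times_iff)
  have transport: "?Q i j s t' \<longleftrightarrow>
      (\<exists>!q. q \<in> X \<times> X \<and> ?e i s \<otimes>\<^bsub>?G\<^esub> ?e j (fst q) = ?e j t' \<otimes>\<^bsub>?G\<^esub> ?e i (snd q))"
    if "i \<in> {1..k}" "j \<in> {1..k}" for i j s t'
    unfolding edges_eq_YB_edge[OF that(1)] edges_eq_YB_edge[OF that(2)]
    using that
    by (intro ex1_Times_image_iff[where P = "\<lambda>a b. ?e i s \<otimes>\<^bsub>?G\<^esub> a = ?e j t' \<otimes>\<^bsub>?G\<^esub> b"] inj_on_YB_edge)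
  have "unique_pullback k ?G
     \<longleftrightarrow> (\<forall>i\<in>{1..k}. \<forall>j\<in>{1..k}. i \<noteq> j \<longrightarrow> (\<forall>s\<in>X. \<forall>t'\<in>X. ?Q i j s t'))"
    by (simp add: unique_pullback_def edges_eq_YB_edge)
  also have "\<dots> \<longleftrightarrow> (\<forall>s\<in>X. \<forall>t'\<in>X. ?S s t')"
  proof (rule all_colour_pairs_iff[OF \<open>k \<ge> 2\<close>]; intro ballI)
    fix i j s t' assume ij: "i \<in> {1..k}" "j \<in> {1..k}" "i < j" and st: "s \<in> X" "t' \<in> X"
    have "?Q i j s t' \<longleftrightarrow> (\<exists>!q. q \<in> X \<times> X \<and> R (s, fst q) = (t', snd q))"
      unfolding transport[OF ij(1,2)]
      using st
      by (intro arg_cong[where f = Ex1] ext conj_cong[OF HOL.refl] YB_edge_mult_eq_iff[OF ij]) auto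
    also have "\<dots> \<longleftrightarrow> ?S s t'"
      using closed[OF st(1)]
      by (intro ex1_transfer[where f = "\<lambda>t. (t, snd (R (s, t)))" and g = fst])
        (simp_all add: mem_Times_iff prod_eq_iff)
    finally show "?Q i j s t' \<longleftrightarrow> ?S s t'" .
  next
    (* The smaller colour now leads on the right, so the square is read in the opposite
       direction. *)
    fix i j s t' assume ij: "i \<in> {1..k}" "j \<in> {1..k}" "j < i" and st: "s \<in> X" "t' \<in> X"
    have "?Q i j s t' \<longleftrightarrow> (\<exists>!q. q \<in> X \<times> X \<and> R (t', snd q) = (s, fst q))"
      unfolding transport[OF ij(1,2)]
      using st
      by (intro arg_cong[where f = Ex1] ext conj_cong[OF HOL.refl]
          HOL.trans[OF eq_commute YB_edge_mult_eq_iff[OF ij(2,1,3)]]) auto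
    also have "\<dots> \<longleftrightarrow> ?S t' s"
      using closed[OF st(2)]
      by (intro ex1_transfer[where f = "\<lambda>t. (snd (R (t', t)), t)" and g = snd])
        (simp_all add: mem_Times_iff prod_eq_iff)
    finally show "?Q i j s t' \<longleftrightarrow> ?S t' s" .
  qed
  also have "\<dots> \<longleftrightarrow> (\<forall>s\<in>X. bij_betw (\<lambda>t. fst (R (s, t))) X X)"
    using closed by (simp add: bij_betw_iff_ex1)
  finally show ?thesis .
qed

lemma unique_pushout_YB_graph_iff:
  assumes R: "R ` (X \<times> X) \<subseteq> X \<times> X" and "k \<ge> 2"
  shows "unique_pushout k (YB_graph k X R)
     \<longleftrightarrow> (\<forall>t\<in>X. bij_betw (\<lambda>s. snd (R (s, t))) X X)"
proof -
  let ?G = "YB_graph k X R" and ?e = "YB_edge k X R"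
  let ?Q = "\<lambda>i j s' t. \<exists>!p. p \<in> edges ?G j \<times> edges ?G i \<and> snd p \<otimes>\<^bsub>?G\<^esub> ?e j t = fst p \<otimes>\<^bsub>?G\<^esub> ?e i s'"
  let ?S = "\<lambda>s' t. \<exists>!s. s \<in> X \<and> snd (R (s, t)) = s'"
  have closed: "fst (R (s, t)) \<in> X" "snd (R (s, t)) \<in> X" if "s \<in> X" "t \<in> X" for s t
    using R that by (auto simp: image_subset_iff mem_Times_iff)
  have transport: "?Q i j s' t \<longleftrightarrow>
      (\<exists>!q. q \<in> X \<times> X \<and> ?e i (snd q) \<otimes>\<^bsub>?G\<^esub> ?e j t = ?e j (fst q) \<otimes>\<^bsub>?G\<^esub> ?e i s')"
    if "i \<in> {1..k}" "j \<in> {1..k}" for i j s' t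
    unfolding edges_eq_YB_edge[OF that(1)] edges_eq_YB_edge[OF that(2)]
    using that
    by (intro ex1_Times_image_iff[where P = "\<lambda>a b. b \<otimes>\<^bsub>?G\<^esub> ?e j t = a \<otimes>\<^bsub>?G\<^esub> ?e i s'"] inj_on_YB_edge)
  have "unique_pushout k ?G
     \<longleftrightarrow> (\<forall>i\<in>{1..k}. \<forall>j\<in>{1..k}. i \<noteq> j \<longrightarrow> (\<forall>s'\<in>X. \<forall>t\<in>X. ?Q i j s' t))"
    by (simp add: unique_pushout_def edges_eq_YB_edge)
  also have "\<dots> \<longleftrightarrow> (\<forall>s'\<in>X. \<forall>t\<in>X. ?S s' t)"
  proof (rule all_colour_pairs_iff[OF \<open>k \<ge> 2\<close>]; intro ballI)
    fix i j s' t assume ij: "i \<in> {1..k}" "j \<in> {1..k}" "i < j" and st: "s' \<in> X" "t \<in> X"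
    have "?Q i j s' t \<longleftrightarrow> (\<exists>!q. q \<in> X \<times> X \<and> R (snd q, t) = (fst q, s'))"
      unfolding transport[OF ij(1,2)]
      using st
      by (intro arg_cong[where f = Ex1] ext conj_cong[OF HOL.refl] YB_edge_mult_eq_iff[OF ij]) auto
    also have "\<dots> \<longleftrightarrow> ?S s' t"
      using closed[OF _ st(2)]
      by (intro ex1_transfer[where f = "\<lambda>s. (fst (R (s, t)), s)" and g = snd])
        (simp_all add: mem_Times_iff prod_eq_iff)
    finally show "?Q i j s' t \<longleftrightarrow> ?S s' t" .
  next
    (* The smaller colour now leads on the right, so the square is read in the opposite
       direction. *)
    fix i j s' t assume ij: "i \<in> {1..k}" "j \<in> {1..k}" "j < i" and st: "s' \<in> X" "t \<in> X"
    have "?Q i j s' t \<longleftrightarrow> (\<exists>!q. q \<in> X \<times> X \<and> R (fst q, s') = (snd q, t))"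
      unfolding transport[OF ij(1,2)]
      using st
      by (intro arg_cong[where f = Ex1] ext conj_cong[OF HOL.refl]
          HOL.trans[OF eq_commute YB_edge_mult_eq_iff[OF ij(2,1,3)]]) auto
    also have "\<dots> \<longleftrightarrow> ?S t s'"
      using closed[OF _ st(1)]
      by (intro ex1_transfer[where f = "\<lambda>s. (s, fst (R (s, s')))" and g = fst])
        (simp_all add: mem_Times_iff prod_eq_iff)
    finally show "?Q i j s' t \<longleftrightarrow> ?S t s'" .
  qed
  also have "\<dots> \<longleftrightarrow> (\<forall>t\<in>X. \<forall>s'\<in>X. ?S s' t)"
    by blast
  also have "\<dots> \<longleftrightarrow> (\<forall>t\<in>X. bij_betw (\<lambda>s. snd (R (s, t))) X X)"
    using closed by (simp add: bij_betw_iff_ex1)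
  finally show ?thesis .
qed

theorem corollary6p4:
  fixes X :: "'a set" and R :: "'a \<times> 'a \<Rightarrow> 'a \<times> 'a"
  assumes "finite X" and "X \<noteq> {}" and "bij_betw R (X \<times> X) (X \<times> X)"
  shows "(nondegenerate X R \<longleftrightarrow>
            unique_pullback 2 (YB_graph 2 X R) \<and> unique_pushout 2 (YB_graph 2 X R)) \<and>
         (yang_baxter_solution X R \<longrightarrow>
            (\<forall>k\<ge>2. nondegenerate X R \<longleftrightarrow>
               unique_pullback k (YB_graph k X R) \<and> unique_pushout k (YB_graph k X R)))"
proof -
  have "R ` (X \<times> X) \<subseteq> X \<times> X"
    using assms(3) by (simp add: bij_betw_def)
  then have "nondegenerate X R \<longleftrightarrow>
      unique_pullback k (YB_graph k X R) \<and> unique_pushout k (YB_graph k X R)" if "k \<ge> 2" for k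
    using that
    by (auto simp: nondegenerate_def unique_pullback_YB_graph_iff unique_pushout_YB_graph_iff)
  then show ?thesis
    by simp
qed

end
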